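(* Let $n\ge 3$, let $M\ge 1$ and $\bar M=\log M$, let $A\in{\cal P}_n\cap[1/M,M]^{n\times n}$, put $\bar a_{ij}=\log a_{ij}$, and let $K\ge 0$ be an integer. Consider the linear mixed 0-1 optimization problem in the real variables $\alpha$, $x_{ij}$ ($1\le i,j\le n$) and the binary variables $y_{ij}$ ($1\le i<j\le n$): $$\begin{array}{rll} \min & \alpha & \\ \mathrm{s.t.} & x_{ij}+x_{jk}+x_{ki}\le \alpha, & 1\le i<j<k\le n,\\ & -(x_{ij}+x_{jk}+x_{ki})\le \alpha, & 1\le i<j<k\le n,\\ & \sum_{i=1}^{n-1}\sum_{j=i+1}^{n} y_{ij}\le K, & \\ & x_{ij}=-x_{ji}, & 1\le i\le j\le n,\\ & -\bar M\le x_{ij}\le \bar M, & 1\le i<j\le n,\\ & -2\bar M y_{ij}\le x_{ij}-\bar a_{ij}\le 2\bar M y_{ij}, & 1\le i<j\le n,\\ & y_{ij}\in\{0,1\}, & 1\le i<j\le n. \end{array}$$ Let $\alpha_{\mathrm{opt}}$ denote its optimum value. Then $1-\dfrac{1}{\exp(\alpha_{\mathrm{opt}})}$ is the minimal value of the inconsistency $CM$ that can be obtained by modifying at most $K$ elements above the main diagonal of $A$ (and their reciprocals), i.e. $$1-\frac{1}{\exp(\alpha_{\mathrm{opt}})}=\min\{\,CM(\hat A)\ :\ \hat A\in{\cal P}_n\cap[1/M,M]^{n\times n},\ d(A,\hat A)\le K\,\}.$$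
   Context: ${\cal P}_n$ is the set of $n\times n$ pairwise comparison matrices: real matrices $A=(a_{ij})$ with $a_{ij}>0$ and $a_{ij}=1/a_{ji}$ for all $i,j$ (so $a_{ii}=1$). $[1/M,M]^{n\times n}$ is the set of $n\times n$ matrices all of whose entries lie in $[1/M,M]$. For $A,\hat A\in{\cal P}_n$, $d(A,\hat A)=|\{(i,j):1\le i<j\le n,\ a_{ij}\ne\hat a_{ij}\}|$. For positive reals $a,b,c$ let $$CM(a,b,c)=\min\left\{\frac1a\left|a-\frac bc\right|,\ \frac1b\left|b-ac\right|,\ \frac1c\left|c-\frac ba\right|\right\},$$ and for $A\in{\cal P}_n$ let $CM(A)=\max\{CM(a_{ij},a_{ik},a_{jk}) : 1\le i<j<k\le n\}$ (the inconsistency index of Koczkodaj and Duszak). *)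

theory Defs
  imports Complex_Main "Jordan_Normal_Form.Matrix"
begin

(* Matrices are indexed from 0, so the index range 1..n becomes 0..n-1 throughout. *)

definition pairwise_comparison_mats :: "nat \<Rightarrow> real mat set" where
  "pairwise_comparison_mats n =
     {A \<in> carrier_mat n n. \<forall>i<n. \<forall>j<n. A $$ (i, j) > 0 \<and> A $$ (i, j) = 1 / A $$ (j, i)}"

definition box_mats :: "nat \<Rightarrow> real \<Rightarrow> real mat set" where
  "box_mats n M = {A \<in> carrier_mat n n. \<forall>i<n. \<forall>j<n. A $$ (i, j) \<in> {1 / M..M}}"

definition pcm_dist :: "nat \<Rightarrow> real mat \<Rightarrow> real mat \<Rightarrow> nat" where
  "pcm_dist n A B = card {(i, j). i < j \<and> j < n \<and> A $$ (i, j) \<noteq> B $$ (i, j)}"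

definition CM_triad :: "real \<Rightarrow> real \<Rightarrow> real \<Rightarrow> real" where
  "CM_triad a b c =
     Min {1 / a * \<bar>a - b / c\<bar>, 1 / b * \<bar>b - a * c\<bar>, 1 / c * \<bar>c - b / a\<bar>}"

(* The set of triads is nonempty, and the maximum therefore meaningful, only for n \<ge> 3. *)
definition CM :: "nat \<Rightarrow> real mat \<Rightarrow> real" where
  "CM n A =
     Max {CM_triad (A $$ (i, j)) (A $$ (i, k)) (A $$ (j, k)) | i j k. i < j \<and> j < k \<and> k < n}"

(* Only the values x i j with i, j < n and y i j with i < j < n are decision variables;
   the remaining values of the functions x and y are unconstrained and play no role. *)
definition milp_feasible ::
  "nat \<Rightarrow> nat \<Rightarrow> real \<Rightarrow> (nat \<Rightarrow> nat \<Rightarrow> real) \<Rightarrow>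
   real \<Rightarrow> (nat \<Rightarrow> nat \<Rightarrow> real) \<Rightarrow> (nat \<Rightarrow> nat \<Rightarrow> real) \<Rightarrow> bool" where
  "milp_feasible n K Mbar abar \<alpha> x y \<longleftrightarrow>
     (\<forall>i j k. i < j \<and> j < k \<and> k < n \<longrightarrow> x i j + x j k + x k i \<le> \<alpha>) \<and>
     (\<forall>i j k. i < j \<and> j < k \<and> k < n \<longrightarrow> - (x i j + x j k + x k i) \<le> \<alpha>) \<and>
     (\<Sum>i = 0..<n - 1. \<Sum>j = i + 1..<n. y i j) \<le> real K \<and>
     (\<forall>i j. i \<le> j \<and> j < n \<longrightarrow> x i j = - x j i) \<and>
     (\<forall>i j. i < j \<and> j < n \<longrightarrow> - Mbar \<le> x i j \<and> x i j \<le> Mbar) \<and>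
     (\<forall>i j. i < j \<and> j < n \<longrightarrow>
        - 2 * Mbar * y i j \<le> x i j - abar i j \<and> x i j - abar i j \<le> 2 * Mbar * y i j) \<and>
     (\<forall>i j. i < j \<and> j < n \<longrightarrow> y i j \<in> {0, 1})"

definition is_minimum :: "real set \<Rightarrow> real \<Rightarrow> bool" where
  "is_minimum S m \<longleftrightarrow> m \<in> S \<and> (\<forall>s\<in>S. m \<le> s)"

end

theory Submission
  imports Defs "HOL-Analysis.Function_Topology"
begin

text \<open>
  Everything becomes linear after taking logarithms. For a triad \<open>(a, b, c)\<close> with
  \<open>s = ln a + ln c - ln b\<close>, the three relative errors in the definition of the index are
  \<open>\<bar>1 - exp (- s)\<bar>\<close>, \<open>\<bar>1 - exp s\<bar>\<close> and again
  \<open>\<bar>1 - exp (- s)\<bar>\<close>, and the smallest of them is \<open>1 - exp (- \<bar>s\<bar>)\<close>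
  (lemma \<open>CM_triad_exp\<close>). As \<open>\<lambda>t. 1 - exp (- t)\<close> is increasing, it commutes with
  the maximum over all triads, so the inconsistency of a matrix is this function applied to the
  largest value of \<open>\<bar>s\<bar>\<close>, the \<open>max_deviation\<close> of the matrix of logarithms
  (lemma \<open>CM_eq_max_deviation\<close>).

  Both optimization problems therefore range over the same set \<open>log_candidates\<close>: the
  upper triangles with entries in \<open>[- ln M, ln M]\<close> that differ from the logarithm of
  \<open>A\<close> in at most \<open>K\<close> places. A matrix is recovered from such a triangle through
  reciprocity, and a feasible point of the linear problem through skew symmetry, with
  \<open>y i j = 1\<close> exactly at the modified places; the constraint with the factor
  \<open>2 * ln M\<close> does not cut anything off there, because two numbers in
  \<open>[- ln M, ln M]\<close> are never further apart. The values \<open>\<alpha>\<close> feasible in the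
  linear problem are then the upper bounds of \<open>max_deviation\<close> values (lemma
  \<open>milp_feasible_iff\<close>), and the attainable inconsistencies are the images of these values
  under \<open>\<lambda>t. 1 - exp (- t)\<close> (lemma \<open>attainable_CM_eq_image\<close>).

  That the minima exist at all is a compactness argument: bounding the number of modified places
  by \<open>K\<close> gives a finite union of closed conditions inside a product of compact intervals
  (lemma \<open>compact_log_candidates\<close>), and \<open>max_deviation\<close> is continuous.
\<close>

section \<open>The index of a triad in logarithmic coordinates\<close>

text \<open>
  For \<open>s \<ge> 0\<close> the competing value \<open>exp s - 1\<close> is the larger one, since it equals
  \<open>exp s * (1 - exp (- s))\<close>; for \<open>s \<le> 0\<close> the roles are exchanged.
\<close>

lemma min_one_minus_exp:
  fixes s :: real
  shows "min \<bar>1 - exp (- s)\<bar> \<bar>1 - exp s\<bar> = 1 - exp (- \<bar>s\<bar>)"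
proof -
  have *: "1 - exp (- t) \<le> exp t - 1" if "t \<ge> 0" for t :: real
  proof -
    have "1 * (1 - exp (- t)) \<le> exp t * (1 - exp (- t))"
      using that by (intro mult_right_mono) auto
    then show ?thesis
      by (simp add: right_diff_distrib exp_minus)
  qed
  show ?thesis
  proof (cases "s \<ge> 0")
    case True
    then show ?thesis
      using *[of s] by (simp add: min_def abs_if)
  next
    case False
    then show ?thesis
      using *[of "- s"] by (simp add: min_def abs_if)
  qed
qed

lemma CM_triad_exp:
  "CM_triad (exp u) (exp v) (exp w) = 1 - exp (- \<bar>u + w - v\<bar>)"
proof -
  have rel: "1 / exp p * \<bar>exp p - exp q\<bar> = \<bar>1 - exp (q - p)\<bar>" for p q :: real
  proof -
    have "1 / exp p * \<bar>exp p - exp q\<bar> = \<bar>(exp p - exp q) / exp p\<bar>"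
      by (simp add: abs_divide)
    then show ?thesis
      by (simp add: diff_divide_distrib exp_diff)
  qed
  have "1 / exp u * \<bar>exp u - exp v / exp w\<bar> = \<bar>1 - exp (- (u + w - v))\<bar>"
    using rel[of u "v - w"] by (simp add: exp_diff algebra_simps)
  moreover have "1 / exp v * \<bar>exp v - exp u * exp w\<bar> = \<bar>1 - exp (u + w - v)\<bar>"
    using rel[of v "u + w"] by (simp add: exp_add)
  moreover have "1 / exp w * \<bar>exp w - exp v / exp u\<bar> = \<bar>1 - exp (- (u + w - v))\<bar>"
    using rel[of w "v - u"] by (simp add: exp_diff algebra_simps)
  ultimately show ?thesis
    by (simp add: CM_triad_def min_one_minus_exp[symmetric] min.commute)
qed

section \<open>The largest deviation from consistency\<close>

definition triads :: "nat \<Rightarrow> (nat \<times> nat \<times> nat) set" where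
  "triads n = {(i, j, k). i < j \<and> j < k \<and> k < n}"

text \<open>
  Only entries above the diagonal enter. For a skew-symmetric \<open>x\<close> the summand
  \<open>- x i k\<close> is the term \<open>x k i\<close> of the cyclic sum in the linear problem.
\<close>

definition max_deviation :: "nat \<Rightarrow> (nat \<Rightarrow> nat \<Rightarrow> real) \<Rightarrow> real" where
  "max_deviation n x = Max ((\<lambda>(i, j, k). \<bar>x i j + x j k - x i k\<bar>) ` triads n)"

lemma finite_triads: "finite (triads n)"
  by (rule finite_subset[of _ "{..<n} \<times> {..<n} \<times> {..<n}"]) (auto simp: triads_def)

lemma triads_nonempty: "n \<ge> 3 \<Longrightarrow> triads n \<noteq> {}"
proof -
  assume "n \<ge> 3"
  then have "(0, 1, 2) \<in> triads n"
    by (simp add: triads_def)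
  then show ?thesis
    by blast
qed

lemma max_deviation_cong:
  assumes "\<And>i j. i < j \<Longrightarrow> j < n \<Longrightarrow> x i j = x' i j"
  shows "max_deviation n x = max_deviation n x'"
  unfolding max_deviation_def using assms
  by (intro arg_cong[of _ _ Max] image_cong) (auto simp: triads_def)

lemma max_deviation_le_iff:
  assumes "n \<ge> 3"
  shows "max_deviation n x \<le> \<alpha> \<longleftrightarrow>
    (\<forall>i j k. i < j \<and> j < k \<and> k < n \<longrightarrow> \<bar>x i j + x j k - x i k\<bar> \<le> \<alpha>)"
  unfolding max_deviation_def using finite_triads[of n] triads_nonempty[OF assms]
  by (subst Max_le_iff) (auto simp: triads_def)

lemma continuous_on_Max_image:
  fixes f :: "'i \<Rightarrow> 'a::topological_space \<Rightarrow> real"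
  assumes "finite I" "I \<noteq> {}" "\<And>i. i \<in> I \<Longrightarrow> continuous_on S (f i)"
  shows "continuous_on S (\<lambda>x. Max ((\<lambda>i. f i x) ` I))"
  using assms
proof (induction I rule: finite_ne_induct)
  case (insert i I)
  have "Max ((\<lambda>i. f i x) ` insert i I) = max (f i x) (Max ((\<lambda>i. f i x) ` I))" for x
    using insert.hyps by simp
  then show ?case
    using insert by (simp add: continuous_on_max)
qed simp

lemma continuous_on_entry:
  "continuous_on S (\<lambda>x :: 'i \<Rightarrow> 'j \<Rightarrow> real. x i j)"
  by (rule continuous_on_product_then_coordinatewise
      [OF continuous_on_product_then_coordinatewise[OF continuous_on_id]])

lemma continuous_on_max_deviation:
  assumes "n \<ge> 3"
  shows "continuous_on S (max_deviation n)"
proof -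
  have "continuous_on S (\<lambda>x. Max ((\<lambda>t. (\<lambda>(i, j, k). \<bar>x i j + x j k - x i k\<bar>) t) ` triads n))"
    using finite_triads triads_nonempty[OF assms]
    by (rule continuous_on_Max_image)
      (auto intro!: continuous_intros continuous_on_entry)
  then show ?thesis
    by (simp add: max_deviation_def[abs_def])
qed

lemma CM_eq_max_deviation:
  assumes "n \<ge> 3" and pos: "\<And>i j. i < j \<Longrightarrow> j < n \<Longrightarrow> B $$ (i, j) > 0"
  shows "CM n B = 1 - exp (- max_deviation n (\<lambda>i j. ln (B $$ (i, j))))"
proof -
  let ?l = "\<lambda>i j. ln (B $$ (i, j))"
  let ?d = "\<lambda>(i, j, k). \<bar>?l i j + ?l j k - ?l i k\<bar>"
  let ?c = "\<lambda>(i, j, k). CM_triad (B $$ (i, j)) (B $$ (i, k)) (B $$ (j, k))"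
  have triad: "?c t = 1 - exp (- ?d t)" if t_in: "t \<in> triads n" for t
  proof -
    obtain i j k where t: "t = (i, j, k)" "i < j" "j < k" "k < n"
      using t_in by (auto simp: triads_def)
    then have "B $$ (i, j) > 0" "B $$ (i, k) > 0" "B $$ (j, k) > 0"
      by (auto intro: pos)
    then show ?thesis
      using CM_triad_exp[of "?l i j" "?l i k" "?l j k"] by (simp add: t(1))
  qed
  have "{CM_triad (B $$ (i, j)) (B $$ (i, k)) (B $$ (j, k)) | i j k. i < j \<and> j < k \<and> k < n}
      = ?c ` triads n"
    unfolding triads_def image_def Bex_def split_paired_Ex mem_Collect_eq prod.case by blast
  also have "\<dots> = (\<lambda>s. 1 - exp (- s)) ` ?d ` triads n"
    unfolding image_image by (rule image_cong[OF refl triad])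
  finally have "CM n B = Max ((\<lambda>s. 1 - exp (- s)) ` ?d ` triads n)"
    by (simp add: CM_def)
  also have "\<dots> = 1 - exp (- Max (?d ` triads n))"
    using finite_triads[of n] triads_nonempty[OF assms(1)]
    by (intro mono_Max_commute[symmetric]) (auto intro: monoI)
  finally show ?thesis
    by (simp add: max_deviation_def)
qed

section \<open>The common search space and its compactness\<close>

definition upper_pairs :: "nat \<Rightarrow> (nat \<times> nat) set" where
  "upper_pairs n = {(i, j). i < j \<and> j < n}"

lemma finite_upper_pairs: "finite (upper_pairs n)"
  by (rule finite_subset[of _ "{..<n} \<times> {..<n}"]) (auto simp: upper_pairs_def)

definition modified_pairs ::
  "nat \<Rightarrow> (nat \<Rightarrow> nat \<Rightarrow> real) \<Rightarrow> (nat \<Rightarrow> nat \<Rightarrow> real) \<Rightarrow> (nat \<times> nat) set" where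
  "modified_pairs n a x = {(i, j). i < j \<and> j < n \<and> x i j \<noteq> a i j}"

lemma modified_pairs_subset: "modified_pairs n a x \<subseteq> upper_pairs n"
  by (auto simp: modified_pairs_def upper_pairs_def)

text \<open>
  The bound is imposed on all entries, also on those outside the upper triangle: this makes the
  set compact in the full function space, and entries outside the triangle can be replaced by
  zero without effect on the deviation.
\<close>

definition log_candidates ::
  "nat \<Rightarrow> nat \<Rightarrow> real \<Rightarrow> (nat \<Rightarrow> nat \<Rightarrow> real) \<Rightarrow> (nat \<Rightarrow> nat \<Rightarrow> real) set" where
  "log_candidates n K L a =
     {x. (\<forall>i j. \<bar>x i j\<bar> \<le> L) \<and> card (modified_pairs n a x) \<le> K}"

lemma compact_PiE_UNIV:
  fixes S :: "'i \<Rightarrow> 'a::topological_space set"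
  assumes "\<And>i. compact (S i)"
  shows "compact (PiE UNIV S)"
  using compactin_PiE[of "\<lambda>_. euclidean" UNIV S] assms
  by (simp add: euclidean_product_topology)

text \<open>
  For a fixed set of modified places, agreement with \<open>a\<close> elsewhere is a closed condition,
  and there are only finitely many sets of places to choose from.
\<close>

lemma compact_log_candidates: "compact (log_candidates n K L a)"
proof -
  let ?box = "PiE UNIV (\<lambda>i :: nat. PiE UNIV (\<lambda>j :: nat. {- L..L}))"
  let ?\<D> = "{D. D \<subseteq> upper_pairs n \<and> card D \<le> K}"
  let ?agree = "\<lambda>D. {x :: nat \<Rightarrow> nat \<Rightarrow> real. \<forall>i j. (i, j) \<in> upper_pairs n - D \<longrightarrow> x i j = a i j}"
  have union: "(\<Union>D\<in>?\<D>. ?agree D) = {x. card (modified_pairs n a x) \<le> K}"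
  proof (intro equalityI subsetI)
    fix x assume "x \<in> (\<Union>D\<in>?\<D>. ?agree D)"
    then obtain D where D: "D \<subseteq> upper_pairs n" "card D \<le> K" "x \<in> ?agree D"
      by auto
    then have "modified_pairs n a x \<subseteq> D"
      by (auto simp: modified_pairs_def upper_pairs_def)
    then have "card (modified_pairs n a x) \<le> card D"
      using D(1) finite_upper_pairs by (meson card_mono finite_subset)
    with D(2) show "x \<in> {x. card (modified_pairs n a x) \<le> K}"
      by simp
  next
    fix x assume "x \<in> {x. card (modified_pairs n a x) \<le> K}"
    then show "x \<in> (\<Union>D\<in>?\<D>. ?agree D)"
      by (intro UN_I[of "modified_pairs n a x"])
        (auto simp: modified_pairs_def upper_pairs_def)
  qed
  have "\<bar>t\<bar> \<le> L \<longleftrightarrow> t \<in> {- L..L}" for t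
    by auto
  then have box: "?box = {x. \<forall>i j. \<bar>x i j\<bar> \<le> L}"
    by (simp only:) (simp add: PiE_def Pi_def)
  have "log_candidates n K L a = ?box \<inter> (\<Union>D\<in>?\<D>. ?agree D)"
    unfolding union box log_candidates_def by blast
  moreover have "compact ?box"
    by (intro compact_PiE_UNIV) simp
  moreover have "closed (\<Union>D\<in>?\<D>. ?agree D)"
  proof (rule closed_UN)
    show "finite ?\<D>"
      by (rule finite_subset[of _ "Pow (upper_pairs n)"]) (auto simp: finite_upper_pairs)
    show "\<forall>D\<in>?\<D>. closed (?agree D)"
      by (intro ballI closed_Collect_all closed_Collect_imp open_Collect_const
          closed_Collect_eq continuous_on_entry continuous_on_const)
  qed
  ultimately show ?thesis
    by (simp add: compact_Int_closed)
qed

text \<open>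
  Truncation to the upper triangle turns an \<open>x\<close> that is bounded only there into a
  candidate.
\<close>

definition upper_part :: "nat \<Rightarrow> (nat \<Rightarrow> nat \<Rightarrow> real) \<Rightarrow> nat \<Rightarrow> nat \<Rightarrow> real" where
  "upper_part n x i j = (if i < j \<and> j < n then x i j else 0)"

lemma max_deviation_upper_part: "max_deviation n (upper_part n x) = max_deviation n x"
  by (rule max_deviation_cong) (simp add: upper_part_def)

lemma upper_part_in_log_candidates:
  assumes "L \<ge> 0" and "\<And>i j. i < j \<Longrightarrow> j < n \<Longrightarrow> \<bar>x i j\<bar> \<le> L"
    and "card (modified_pairs n a x) \<le> K"
  shows "upper_part n x \<in> log_candidates n K L a"
proof -
  have "modified_pairs n a (upper_part n x) = modified_pairs n a x"
    by (auto simp: modified_pairs_def upper_part_def)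
  then show ?thesis
    using assms by (auto simp: log_candidates_def upper_part_def)
qed

section \<open>The linear problem\<close>

lemma sum_upper_pairs:
  fixes y :: "nat \<Rightarrow> nat \<Rightarrow> real"
  shows "(\<Sum>i = 0..<n - 1. \<Sum>j = i + 1..<n. y i j) = (\<Sum>(i, j)\<in>upper_pairs n. y i j)"
proof -
  have "upper_pairs n = Sigma {0..<n - 1} (\<lambda>i. {i + 1..<n})"
    by (auto simp: upper_pairs_def)
  then show ?thesis
    by (simp add: sum.Sigma)
qed

definition skew_extension :: "(nat \<Rightarrow> nat \<Rightarrow> real) \<Rightarrow> nat \<Rightarrow> nat \<Rightarrow> real" where
  "skew_extension x i j = (if i < j then x i j else if j < i then - x j i else 0)"

text \<open>
  A binary \<open>y\<close> satisfying the constraints must be \<open>1\<close> at every modified place, so its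
  sum bounds their number; conversely the indicator of the modified places is feasible.
\<close>

lemma milp_feasible_iff:
  assumes n: "n \<ge> 3" and L: "L \<ge> 0"
    and a: "\<And>i j. i < j \<Longrightarrow> j < n \<Longrightarrow> \<bar>a i j\<bar> \<le> L"
  shows "(\<exists>x y. milp_feasible n K L a \<alpha> x y) \<longleftrightarrow>
    (\<exists>x\<in>log_candidates n K L a. max_deviation n x \<le> \<alpha>)"
proof
  assume "\<exists>x y. milp_feasible n K L a \<alpha> x y"
  then obtain x y where feas: "milp_feasible n K L a \<alpha> x y"
    by blast
  have cycle: "\<forall>i j k. i < j \<and> j < k \<and> k < n \<longrightarrow> x i j + x j k + x k i \<le> \<alpha>"
      "\<forall>i j k. i < j \<and> j < k \<and> k < n \<longrightarrow> - (x i j + x j k + x k i) \<le> \<alpha>"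
    using feas unfolding milp_feasible_def by - (elim conjE, assumption)+
  have skew: "x i j = - x j i" if "i < j" "j < n" for i j
    using feas that unfolding milp_feasible_def by (meson less_imp_le)
  have range: "- L \<le> x i j \<and> x i j \<le> L"
    and change: "- 2 * L * y i j \<le> x i j - a i j \<and> x i j - a i j \<le> 2 * L * y i j"
    and binary: "y i j \<in> {0, 1}" if "i < j" "j < n" for i j
    using feas that unfolding milp_feasible_def by blast+
  have bound: "\<bar>x i j\<bar> \<le> L" if "i < j" "j < n" for i j
    using range[OF that] by (simp add: abs_le_iff)
  have dev: "\<bar>x i j + x j k - x i k\<bar> \<le> \<alpha>" if "i < j" "j < k" "k < n" for i j k
  proof -
    have "x i k = - x k i"
      using that by (intro skew) auto
    moreover have "x i j + x j k + x k i \<le> \<alpha>" "- (x i j + x j k + x k i) \<le> \<alpha>"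
      using that cycle by simp_all
    ultimately show ?thesis
      by linarith
  qed
  have unit: "y i j = 1" if "(i, j) \<in> modified_pairs n a x" for i j
  proof (rule ccontr)
    assume "y i j \<noteq> 1"
    then have "y i j = 0"
      using binary[of i j] that by (auto simp: modified_pairs_def)
    then show False
      using change[of i j] that by (simp add: modified_pairs_def)
  qed
  have "real (card (modified_pairs n a x)) = (\<Sum>(i, j)\<in>modified_pairs n a x. y i j)"
    using unit by (simp add: case_prod_beta')
  also have "\<dots> \<le> (\<Sum>(i, j)\<in>upper_pairs n. y i j)"
  proof (rule sum_mono2[OF finite_upper_pairs modified_pairs_subset])
    show "0 \<le> (case p of (i, j) \<Rightarrow> y i j)" if "p \<in> upper_pairs n - modified_pairs n a x" for p
      using that binary[of "fst p" "snd p"] by (auto simp: upper_pairs_def)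
  qed
  also have "\<dots> \<le> real K"
    using feas unfolding milp_feasible_def sum_upper_pairs by (elim conjE)
  finally have "upper_part n x \<in> log_candidates n K L a"
    using L bound by (intro upper_part_in_log_candidates) auto
  moreover have "max_deviation n (upper_part n x) \<le> \<alpha>"
    unfolding max_deviation_upper_part using dev by (simp add: max_deviation_le_iff[OF n])
  ultimately show "\<exists>x\<in>log_candidates n K L a. max_deviation n x \<le> \<alpha>"
    by blast
next
  assume "\<exists>x\<in>log_candidates n K L a. max_deviation n x \<le> \<alpha>"
  then obtain x where x: "x \<in> log_candidates n K L a" and "max_deviation n x \<le> \<alpha>"
    by blast
  then have dev: "\<bar>x i j + x j k - x i k\<bar> \<le> \<alpha>" if "i < j" "j < k" "k < n" for i j k
    using that by (simp add: max_deviation_le_iff[OF n])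
  have bound: "\<bar>x i j\<bar> \<le> L" for i j
    using x by (simp add: log_candidates_def)
  define y :: "nat \<Rightarrow> nat \<Rightarrow> real" where "y i j = of_bool (x i j \<noteq> a i j)" for i j
  have "(\<Sum>(i, j)\<in>upper_pairs n. y i j) = (\<Sum>(i, j)\<in>modified_pairs n a x. y i j)"
    by (rule sum.mono_neutral_right[OF finite_upper_pairs modified_pairs_subset])
      (auto simp: y_def modified_pairs_def upper_pairs_def)
  also have "\<dots> = (\<Sum>p\<in>modified_pairs n a x. 1)"
    by (intro sum.cong) (auto simp: y_def modified_pairs_def)
  also have "\<dots> \<le> real K"
    using x by (simp add: log_candidates_def)
  finally have "(\<Sum>(i, j)\<in>upper_pairs n. y i j) \<le> real K" .
  moreover have "- 2 * L * y i j \<le> x i j - a i j \<and> x i j - a i j \<le> 2 * L * y i j"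
    if "i < j" "j < n" for i j
    using a[OF that] bound[of i j] by (auto simp: y_def)
  moreover have "x i j + x j k - x i k \<le> \<alpha>" "- (x i j + x j k - x i k) \<le> \<alpha>"
    if "i < j" "j < k" "k < n" for i j k
    using dev[OF that] by linarith+
  moreover have "- L \<le> x i j" "x i j \<le> L" for i j
    using bound[of i j] by linarith+
  moreover have "y i j \<in> {0, 1}" for i j
    by (simp add: y_def)
  ultimately have "milp_feasible n K L a \<alpha> (skew_extension x) y"
    unfolding milp_feasible_def sum_upper_pairs by (auto simp: skew_extension_def)
  then show "\<exists>x y. milp_feasible n K L a \<alpha> x y"
    by blast
qed

section \<open>The attainable inconsistencies\<close>

text \<open>
  Membership in the box is symmetric under reciprocals, which is why a bound on the
  logarithms above the diagonal controls the whole matrix.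
\<close>

lemma exp_matrix_in_box:
  assumes "M \<ge> 1" and bound: "\<And>i j. \<bar>x i j\<bar> \<le> ln M"
  shows "mat n n (\<lambda>(i, j). exp (skew_extension x i j)) \<in>
    pairwise_comparison_mats n \<inter> box_mats n M"
proof -
  have skew: "skew_extension x i j = - skew_extension x j i" for i j
    by (auto simp: skew_extension_def)
  have entry: "1 / M \<le> exp (skew_extension x i j) \<and> exp (skew_extension x i j) \<le> M" for i j
  proof -
    have "\<bar>skew_extension x i j\<bar> \<le> ln M"
      using assms by (auto simp: skew_extension_def)
    then have "exp (- ln M) \<le> exp (skew_extension x i j)"
      and "exp (skew_extension x i j) \<le> exp (ln M)"
      unfolding exp_le_cancel_iff by linarith+
    then show ?thesis
      using assms(1) by (simp add: exp_minus inverse_eq_divide)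
  qed
  have recip: "exp (skew_extension x i j) = 1 / exp (skew_extension x j i)" for i j
    using skew[of i j] by (simp add: exp_minus inverse_eq_divide)
  show ?thesis
    unfolding pairwise_comparison_mats_def box_mats_def using entry
    by (auto simp: recip[symmetric])
qed

lemma abs_ln_box_entry:
  assumes "M \<ge> 1" "B \<in> box_mats n M" "i < n" "j < n"
  shows "\<bar>ln (B $$ (i, j))\<bar> \<le> ln M"
proof -
  have B: "1 / M \<le> B $$ (i, j)" "B $$ (i, j) \<le> M"
    using assms by (auto simp: box_mats_def)
  moreover from B(1) have "0 < B $$ (i, j)"
    using assms(1) by (smt (verit) divide_pos_pos)
  ultimately have "ln (1 / M) \<le> ln (B $$ (i, j))" "ln (B $$ (i, j)) \<le> ln M"
    using assms(1) by (auto intro: ln_mono)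
  then show ?thesis
    using assms(1) by (simp add: ln_div abs_le_iff)
qed

lemma pairwise_comparison_mats_pos:
  "A \<in> pairwise_comparison_mats n \<Longrightarrow> i < j \<Longrightarrow> j < n \<Longrightarrow> A $$ (i, j) > 0"
  unfolding pairwise_comparison_mats_def mem_Collect_eq by (meson less_trans)

text \<open>Since \<open>ln\<close> is injective on positive numbers, taking it preserves which entries differ.\<close>

lemma pcm_dist_eq_card_modified_pairs:
  assumes "A \<in> pairwise_comparison_mats n" "B \<in> pairwise_comparison_mats n"
  shows "pcm_dist n A B =
    card (modified_pairs n (\<lambda>i j. ln (A $$ (i, j))) (\<lambda>i j. ln (B $$ (i, j))))"
proof -
  have "ln (B $$ (i, j)) \<noteq> ln (A $$ (i, j)) \<longleftrightarrow> A $$ (i, j) \<noteq> B $$ (i, j)"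
    if "i < j" "j < n" for i j
    using assms[THEN pairwise_comparison_mats_pos, OF that] by auto
  then show ?thesis
    unfolding pcm_dist_def modified_pairs_def
    by (intro arg_cong[of _ _ card]) blast
qed

lemma attainable_CM_eq_image:
  assumes n: "n \<ge> 3" and M: "M \<ge> 1"
    and A: "A \<in> pairwise_comparison_mats n"
  shows "{CM n B | B. B \<in> pairwise_comparison_mats n \<inter> box_mats n M \<and> pcm_dist n A B \<le> K} =
    (\<lambda>x. 1 - exp (- max_deviation n x)) `
      log_candidates n K (ln M) (\<lambda>i j. ln (A $$ (i, j)))"
    (is "?V = ?f ` ?X")
proof (intro equalityI subsetI)
  fix v assume "v \<in> ?V"
  then obtain B where v: "v = CM n B" and B: "B \<in> pairwise_comparison_mats n" "B \<in> box_mats n M"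
    and dist: "pcm_dist n A B \<le> K"
    by blast
  let ?l = "\<lambda>i j. ln (B $$ (i, j))"
  have "\<bar>?l i j\<bar> \<le> ln M" if "i < j" "j < n" for i j
    using M B(2) that by (intro abs_ln_box_entry) auto
  then have "upper_part n ?l \<in> ?X"
    using M dist pcm_dist_eq_card_modified_pairs[OF A B(1)]
    by (intro upper_part_in_log_candidates) auto
  moreover have "v = ?f (upper_part n ?l)"
    unfolding v max_deviation_upper_part
    by (intro CM_eq_max_deviation[OF n] pairwise_comparison_mats_pos[OF B(1)])
  ultimately show "v \<in> ?f ` ?X"
    by blast
next
  fix v assume "v \<in> ?f ` ?X"
  then obtain x where v: "v = ?f x" and x: "x \<in> ?X"
    by blast
  define B where "B = mat n n (\<lambda>(i, j). exp (skew_extension x i j))"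
  have B: "B \<in> pairwise_comparison_mats n \<inter> box_mats n M"
    unfolding B_def using M x by (intro exp_matrix_in_box) (auto simp: log_candidates_def)
  have entry: "ln (B $$ (i, j)) = x i j" "B $$ (i, j) > 0" if "i < j" "j < n" for i j
    using that by (simp_all add: B_def skew_extension_def)
  then have "modified_pairs n (\<lambda>i j. ln (A $$ (i, j))) (\<lambda>i j. ln (B $$ (i, j))) =
      modified_pairs n (\<lambda>i j. ln (A $$ (i, j))) x"
    by (auto simp: modified_pairs_def)
  then have "pcm_dist n A B \<le> K"
    using x B pcm_dist_eq_card_modified_pairs[OF A, of B] by (simp add: log_candidates_def)
  moreover have "CM n B = v"
    using CM_eq_max_deviation[OF n entry(2)] max_deviation_cong[OF entry(1)]
    by (simp add: v)
  ultimately show "v \<in> ?V"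
    using B by blast
qed

section \<open>Equality of the two optima\<close>

text \<open>
  One candidate of least deviation solves both problems, and \<open>A\<close> itself, modified nowhere,
  shows that there are candidates.
\<close>

theorem theorem7:
  fixes n K :: nat and M :: real and A :: "real mat"
  assumes "n \<ge> 3"
    and "M \<ge> 1"
    and "A \<in> pairwise_comparison_mats n \<inter> box_mats n M"
  shows "\<exists>\<alpha>_opt.
    is_minimum {\<alpha>. \<exists>x y. milp_feasible n K (ln M) (\<lambda>i j. ln (A $$ (i, j))) \<alpha> x y} \<alpha>_opt \<and>
    is_minimum {CM n B | B. B \<in> pairwise_comparison_mats n \<inter> box_mats n M \<and> pcm_dist n A B \<le> K}
      (1 - 1 / exp \<alpha>_opt)"
proof -
  let ?a = "\<lambda>i j. ln (A $$ (i, j))"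
  let ?X = "log_candidates n K (ln M) ?a"
  have A: "A \<in> pairwise_comparison_mats n" "A \<in> box_mats n M"
    using assms(3) by auto
  have L: "ln M \<ge> 0"
    using assms(2) by simp
  have a: "\<bar>?a i j\<bar> \<le> ln M" if "i < j" "j < n" for i j
    using assms(2) A(2) that by (intro abs_ln_box_entry) auto
  have "upper_part n ?a \<in> ?X"
    using L a by (intro upper_part_in_log_candidates) (auto simp: modified_pairs_def)
  then obtain x where x: "x \<in> ?X" and least: "\<And>x'. x' \<in> ?X \<Longrightarrow> max_deviation n x \<le> max_deviation n x'"
    using continuous_attains_inf[OF compact_log_candidates _ continuous_on_max_deviation[OF assms(1)],
        of n K "ln M" ?a] by blast
  have "(\<exists>x y. milp_feasible n K (ln M) ?a \<alpha> x y) \<longleftrightarrow> (\<exists>x\<in>?X. max_deviation n x \<le> \<alpha>)" for \<alpha>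
    using assms(1) L a by (rule milp_feasible_iff)
  then have "is_minimum {\<alpha>. \<exists>x y. milp_feasible n K (ln M) ?a \<alpha> x y} (max_deviation n x)"
    unfolding is_minimum_def using x least by (simp only: mem_Collect_eq) (blast intro: order_trans)
  moreover have "is_minimum
      {CM n B | B. B \<in> pairwise_comparison_mats n \<inter> box_mats n M \<and> pcm_dist n A B \<le> K}
      (1 - 1 / exp (max_deviation n x))"
  proof -
    have "1 - 1 / exp (max_deviation n x) = 1 - exp (- max_deviation n x)"
      by (simp add: exp_minus inverse_eq_divide)
    then show ?thesis
      unfolding is_minimum_def attainable_CM_eq_image[OF assms(1,2) A(1)]
      using x least by auto
  qed
  ultimately show ?thesis
    by blast
qed

end
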